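(* Let $f$ and $\mathcal S$ satisfy the standing assumptions, let $\{x_k\}$, $\{d_k\}$ be the sequences produced by the Armijo line search-based algorithm, and assume that $\mathcal S$ is a compact set. Then $\{x_k\}$ admits accumulation points, and every accumulation point of $\{x_k\}$ is a stationary point for the problem $\min_{x\in\mathcal S}f(x)$.
   Context: Standing assumptions: $\mathcal S\subset\mathbb R^n$ is a (nonempty) closed convex set; $f:\mathbb R^n\to\mathbb R$ is smooth, possibly nonconvex; there is $f^*\in\mathbb R$ with $f(x)\ge f^*$ for all $x\in\mathcal S$; and there are $L>0$ and an open convex set $\mathcal D\supseteq\mathcal S$ such that $\|\nabla f(x)-\nabla f(y)\|\le L\|x-y\|$ for all $x,y\in\mathcal D$. Norms are Euclidean. Notation: $\mathcal P_{\mathcal S}[x]=\arg\min_{y\in\mathcal S}\|x-y\|$ is the Euclidean projection, and for $\eta>0$ and $x\in\mathcal S$, $\phi_\eta(x)=\|\mathcal P_{\mathcal S}[x-\eta\nabla f(x)]-x\|$. A point $\bar x\in\mathcal S$ is stationary for $\min_{x\in\mathcal S}f(x)$ if $\nabla f(\bar x)^T(x-\bar x)\ge0$ for all $x\in\mathcal S$. Direction assumption (for sequences $\{x_k\}\subseteq\mathcal S$, $\{d_k\}\subseteq\mathbb R^n$, a scalar $\eta>0$ and constants $a,c_1,c_2>0$): for all $k$, (i) $x_k+\alpha d_k\in\mathcal S$ for all $\alpha\in[0,a]$; (ii) $\nabla f(x_k)^Td_k\le -c_1\|d_k\|^2$; (iii) $\nabla f(x_k)^Td_k\le -c_2\,\phi_\eta(x_k)^2$.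 Armijo line search-based algorithm: given $x_0\in\mathcal S$, $a>0$, $\gamma,\delta\in(0,1)$, $\eta>0$, for $k=0,1,\dots$: compute $d_k$ satisfying the direction assumption (with the same constants $a,c_1,c_2>0$ for all $k$); set $\alpha=a$; while $f(x_k+\alpha d_k)>f(x_k)+\gamma\alpha\nabla f(x_k)^Td_k$, replace $\alpha$ by $\delta\alpha$; set $\alpha_k=\alpha$ and $x_{k+1}=x_k+\alpha_kd_k$. *)

theory Defs
  imports "HOL-Analysis.Analysis" "HOL-Library.While_Combinator"
begin

definition grad :: "('a::euclidean_space \<Rightarrow> real) \<Rightarrow> 'a \<Rightarrow> 'a" where
  "grad f x = (THE D. GDERIV f x :> D)"

lemma GDERIV_grad:
  fixes f :: "'a::euclidean_space \<Rightarrow> real"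
  assumes "f differentiable (at x)"
  shows "GDERIV f x :> grad f x"
proof -
  obtain f' where f': "(f has_derivative f') (at x)"
    using assms unfolding differentiable_def by blast
  then have lin: "linear f'"
    by (rule has_derivative_linear)
  have "f' = (\<lambda>h. h \<bullet> adjoint f' 1)"
    using adjoint_works[OF lin, of _ 1] by (auto simp: fun_eq_iff)
  then have D: "GDERIV f x :> adjoint f' 1"
    using f' unfolding gderiv_def by simp
  have "E = adjoint f' 1" if "GDERIV f x :> E" for E
  proof -
    have "(\<lambda>h. h \<bullet> E) = (\<lambda>h. h \<bullet> adjoint f' 1)"
      using that D has_derivative_unique unfolding gderiv_def by blast
    then show ?thesis
      by (metis vector_eq_ldot)
  qed
  with D show ?thesis
    unfolding grad_def by (metis theI)
qed

text \<open>``Smooth'' is read as continuously differentiable on the whole space.\<close>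

definition smooth_fun :: "('a::euclidean_space \<Rightarrow> real) \<Rightarrow> bool" where
  "smooth_fun f \<longleftrightarrow> (\<forall>x. f differentiable (at x)) \<and> continuous_on UNIV (grad f)"

definition proj_residual :: "('a::euclidean_space \<Rightarrow> real) \<Rightarrow> 'a set \<Rightarrow> real \<Rightarrow> 'a \<Rightarrow> real" where
  "proj_residual f S \<eta> x = norm (closest_point S (x - \<eta> *\<^sub>R grad f x) - x)"

definition stationary_point :: "('a::euclidean_space \<Rightarrow> real) \<Rightarrow> 'a set \<Rightarrow> 'a \<Rightarrow> bool" where
  "stationary_point f S x \<longleftrightarrow> x \<in> S \<and> (\<forall>y\<in>S. grad f x \<bullet> (y - x) \<ge> 0)"

definition admissible_direction ::
  "('a::euclidean_space \<Rightarrow> real) \<Rightarrow> 'a set \<Rightarrow> real \<Rightarrow> real \<Rightarrow> real \<Rightarrow> real \<Rightarrow> 'a \<Rightarrow> 'a \<Rightarrow> bool" where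
  "admissible_direction f S \<eta> a c1 c2 x d \<longleftrightarrow>
     (\<forall>\<alpha>\<in>{0..a}. x + \<alpha> *\<^sub>R d \<in> S) \<and>
     grad f x \<bullet> d \<le> - c1 * (norm d)\<^sup>2 \<and>
     grad f x \<bullet> d \<le> - c2 * (proj_residual f S \<eta> x)\<^sup>2"

text \<open>The combinator \<^const>\<open>while\<close> is unspecified if the loop diverges, so termination of the
  backtracking is not assumed; it has to be derived from the other hypotheses.\<close>

definition armijo_step ::
  "('a::euclidean_space \<Rightarrow> real) \<Rightarrow> real \<Rightarrow> real \<Rightarrow> real \<Rightarrow> 'a \<Rightarrow> 'a \<Rightarrow> real" where
  "armijo_step f a \<gamma> \<delta> x d =
     while (\<lambda>\<alpha>. f (x + \<alpha> *\<^sub>R d) > f x + \<gamma> * \<alpha> * (grad f x \<bullet> d)) (\<lambda>\<alpha>. \<delta> * \<alpha>) a"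

text \<open>The search directions are not determined by the algorithm, so a run is a pair of
  sequences. That every iterate lies in \<^term>\<open>S\<close> follows from the first clause of
  \<^const>\<open>admissible_direction\<close> once the backtracking terminates.\<close>

definition armijo_run ::
  "('a::euclidean_space \<Rightarrow> real) \<Rightarrow> 'a set \<Rightarrow> real \<Rightarrow> real \<Rightarrow> real \<Rightarrow> real \<Rightarrow> real \<Rightarrow> real \<Rightarrow>
     (nat \<Rightarrow> 'a) \<Rightarrow> (nat \<Rightarrow> 'a) \<Rightarrow> bool" where
  "armijo_run f S \<eta> a c1 c2 \<gamma> \<delta> x d \<longleftrightarrow>
     x 0 \<in> S \<and>
     (\<forall>k. admissible_direction f S \<eta> a c1 c2 (x k) (d k) \<and>
          x (Suc k) = x k + armijo_step f a \<gamma> \<delta> (x k) (d k) *\<^sub>R d k)"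

text \<open>Accumulation points of a sequence, not limit points of its range: the two differ, for
  instance, for eventually constant sequences.\<close>

definition accumulation_point :: "(nat \<Rightarrow> 'a::topological_space) \<Rightarrow> 'a \<Rightarrow> bool" where
  "accumulation_point x p \<longleftrightarrow> (\<exists>r. strict_mono r \<and> (x \<circ> r) \<longlonglongrightarrow> p)"

end

theory Submission
  imports Defs
begin

text \<open>Along an admissible direction the Lipschitz gradient makes the Armijo test succeed for every
  trial step below the threshold $(1-\gamma) c_1 / L$, so the backtracking terminates with
  a step bounded away from zero. Each iteration then decreases $f$ by a fixed multiple of the squared
  projection residual; as $f$ is bounded below on $S$, the residuals tend to zero, and by continuity
  of the projection they vanish at accumulation points.\<close>

text \<open>The mean value theorem on the segment, rather than integration along it, gives the
  factor \<open>L\<close> instead of the sharp \<open>L / 2\<close>. This only affects the size of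
  the guaranteed step.\<close>

lemma lipschitz_grad_upper_bound:
  fixes f :: "'a::euclidean_space \<Rightarrow> real"
  assumes diff: "\<And>z. f differentiable (at z)"
    and lip: "L-lipschitz_on S (grad f)"
    and segment: "closed_segment u (u + h) \<subseteq> S"
  shows "f (u + h) \<le> f u + grad f u \<bullet> h + L * (norm h)\<^sup>2"
proof -
  define g where "g t = f (u + t *\<^sub>R h)" for t :: real
  have der: "(g has_real_derivative (h \<bullet> grad f (u + t *\<^sub>R h))) (at t)" for t
  proof -
    have "(f has_derivative (\<lambda>v. v \<bullet> grad f (u + t *\<^sub>R h))) (at (u + t *\<^sub>R h))"
      using GDERIV_grad[OF diff] unfolding gderiv_def .
    moreover have "((\<lambda>t. u + t *\<^sub>R h) has_derivative (\<lambda>s. s *\<^sub>R h)) (at t)"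
      by (auto intro!: derivative_eq_intros)
    ultimately have "((\<lambda>t. f (u + t *\<^sub>R h)) has_derivative (\<lambda>s. (s *\<^sub>R h) \<bullet> grad f (u + t *\<^sub>R h))) (at t)"
      by (rule has_derivative_compose[rotated])
    then show ?thesis
      unfolding g_def has_field_derivative_def
      by (rule has_derivative_eq_rhs) (auto simp: mult.commute)
  qed
  obtain t where t: "0 < t" "t < 1" and "g 1 - g 0 = (1 - 0) * (h \<bullet> grad f (u + t *\<^sub>R h))"
    using MVT2[of 0 1 g "\<lambda>t. h \<bullet> grad f (u + t *\<^sub>R h)"] der by auto
  then have eq: "f (u + h) - f u = h \<bullet> grad f (u + t *\<^sub>R h)"
    by (simp add: g_def)
  have "u + t *\<^sub>R h \<in> closed_segment u (u + h)"
    using t by (auto simp: closed_segment_def algebra_simps intro!: exI[of _ t])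
  then have "u + t *\<^sub>R h \<in> S" "u \<in> S"
    using segment by auto
  then have "dist (grad f (u + t *\<^sub>R h)) (grad f u) \<le> L * dist (u + t *\<^sub>R h) u"
    by (rule lipschitz_onD[OF lip])
  \<comment> \<open>The intermediate point is known only to satisfy \<open>0 < t < 1\<close>, so
    \<open>t\<close> is bounded by 1; here the sharper constant is given up.\<close>
  also have "\<dots> \<le> L * norm h"
    using t lipschitz_on_nonneg[OF lip]
    by (intro mult_left_mono) (auto simp: dist_norm mult_left_le_one_le)
  finally have *: "norm (grad f (u + t *\<^sub>R h) - grad f u) \<le> L * norm h"
    by (simp add: dist_norm)
  have "h \<bullet> (grad f (u + t *\<^sub>R h) - grad f u) \<le> norm h * norm (grad f (u + t *\<^sub>R h) - grad f u)"
    by (rule norm_cauchy_schwarz)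
  also have "\<dots> \<le> norm h * (L * norm h)"
    using * by (intro mult_left_mono) auto
  finally show ?thesis
    using eq by (simp add: inner_diff_right inner_commute power2_eq_square algebra_simps)
qed

text \<open>The quadratic error is \<open>L * \<alpha>\<^sup>2 * (norm d)\<^sup>2\<close>, while the
  test leaves a slack of \<open>(1 - \<gamma>) * \<alpha>\<close> times
  \<open>- (grad f x \<bullet> d)\<close>. The second clause of \<open>admissible_direction\<close>
  bounds this slack below by a multiple of \<open>(norm d)\<^sup>2\<close>; comparing the two gives
  the threshold.\<close>

lemma armijo_condition_small_step:
  fixes f :: "'a::euclidean_space \<Rightarrow> real"
  assumes diff: "\<And>z. f differentiable (at z)"
    and lip: "L-lipschitz_on S (grad f)" and L: "L > 0"
    and adm: "admissible_direction f S \<eta> a c1 c2 x d"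
    and \<gamma>: "\<gamma> < 1" and \<alpha>: "0 < \<alpha>" "\<alpha> \<le> a" "\<alpha> \<le> (1 - \<gamma>) * c1 / L"
  shows "f (x + \<alpha> *\<^sub>R d) \<le> f x + \<gamma> * \<alpha> * (grad f x \<bullet> d)"
proof -
  \<comment> \<open>The first clause of \<open>admissible_direction\<close> covers all steps up to
    \<open>a\<close>, hence the whole segment.\<close>
  have "closed_segment x (x + \<alpha> *\<^sub>R d) \<subseteq> S"
  proof
    fix z assume "z \<in> closed_segment x (x + \<alpha> *\<^sub>R d)"
    then obtain t where t: "0 \<le> t" "t \<le> 1" and z: "z = x + (t * \<alpha>) *\<^sub>R d"
      by (auto simp: closed_segment_def algebra_simps)
    have "t * \<alpha> \<le> a"
      using t \<alpha> mult_left_le_one_le[of \<alpha> t] by linarith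
    then show "z \<in> S"
      using adm t \<alpha> z by (auto simp: admissible_direction_def)
  qed
  from lipschitz_grad_upper_bound[OF diff lip this]
  have up: "f (x + \<alpha> *\<^sub>R d) \<le> f x + \<alpha> * (grad f x \<bullet> d) + L * (\<alpha>\<^sup>2 * (norm d)\<^sup>2)"
    by (simp add: power_mult_distrib)
  have "L * \<alpha> * (norm d)\<^sup>2 \<le> (1 - \<gamma>) * c1 * (norm d)\<^sup>2"
    using \<alpha> L by (intro mult_right_mono) (auto simp: field_simps)
  also have "\<dots> = (1 - \<gamma>) * (c1 * (norm d)\<^sup>2)"
    by simp
  also have "\<dots> \<le> (1 - \<gamma>) * (- (grad f x \<bullet> d))"
    using adm \<gamma> by (intro mult_left_mono) (auto simp: admissible_direction_def)
  finally have "\<alpha> * (L * \<alpha> * (norm d)\<^sup>2) \<le> \<alpha> * ((1 - \<gamma>) * (- (grad f x \<bullet> d)))"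
    using \<alpha> by (intro mult_left_mono) auto
  with up show ?thesis
    by (simp add: algebra_simps power2_eq_square)
qed

text \<open>Either the initial trial \<open>a\<close> is accepted, or the last rejected trial was
  larger than \<tau>, and a single multiplication by \<delta> keeps the accepted step above
  \<open>\<delta> * \<tau>\<close>. The minimum of the two cases serves as loop invariant.\<close>

lemma armijo_step_bounds:
  fixes f :: "'a::euclidean_space \<Rightarrow> real"
  assumes a: "a > 0" and \<delta>: "0 < \<delta>" "\<delta> < 1" and \<tau>: "\<tau> > 0"
    and test: "\<And>\<alpha>. \<lbrakk>0 < \<alpha>; \<alpha> \<le> a; \<alpha> \<le> \<tau>\<rbrakk> \<Longrightarrow> f (x + \<alpha> *\<^sub>R d) \<le> f x + \<gamma> * \<alpha> * (grad f x \<bullet> d)"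
  defines "\<alpha> \<equiv> armijo_step f a \<gamma> \<delta> x d"
  shows "min a (\<delta> * \<tau>) \<le> \<alpha> \<and> \<alpha> \<le> a \<and> f (x + \<alpha> *\<^sub>R d) \<le> f x + \<gamma> * \<alpha> * (grad f x \<bullet> d)"
proof -
  \<comment> \<open>A rejected trial step exceeds \<open>\<tau>\<close>, so it shrinks by at least \<open>\<epsilon>\<close>.\<close>
  define \<epsilon> where "\<epsilon> = (1 - \<delta>) * \<tau>"
  have \<epsilon>: "\<epsilon> > 0"
    using \<delta> \<tau> by (simp add: \<epsilon>_def)
  show ?thesis
    unfolding \<alpha>_def armijo_step_def
  \<comment> \<open>Measuring \<alpha> in units of \<epsilon> and rounding up turns a decrease by at
    least \<epsilon> into a strict decrease of a natural number.\<close>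
  proof (rule while_rule[where P = "\<lambda>\<alpha>. min a (\<delta> * \<tau>) \<le> \<alpha> \<and> \<alpha> \<le> a"
        and r = "Wellfounded.measure (\<lambda>\<alpha>. nat \<lceil>\<alpha> / \<epsilon>\<rceil>)"], goal_cases)
    case 1
    then show ?case by simp
  next
    case (2 s)
    have "0 < s"
      using 2 a \<delta> \<tau> by (auto simp: min_def split: if_splits intro: less_le_trans[OF mult_pos_pos])
    with 2 have "s > \<tau>"
      using test[of s] by force
    then have "\<delta> * \<tau> \<le> \<delta> * s"
      using \<delta> by simp
    moreover have "\<delta> * s \<le> s"
      using \<delta> \<open>0 < s\<close> by simp
    ultimately show ?case
      using 2 by linarith
  next
    case (3 s)
    then show ?case by auto
  next
    case 4
    show ?case by simp
  next
    case (5 s)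
    have "0 < s"
      using 5 a \<delta> \<tau> by (auto simp: min_def split: if_splits intro: less_le_trans[OF mult_pos_pos])
    with 5 have "s > \<tau>"
      using test[of s] by force
    then have "\<epsilon> \<le> (1 - \<delta>) * s"
      using \<delta> unfolding \<epsilon>_def by (intro mult_left_mono) auto
    then have "\<delta> * s / \<epsilon> \<le> s / \<epsilon> - 1"
      using \<epsilon> by (simp add: field_simps)
    then have "\<lceil>\<delta> * s / \<epsilon>\<rceil> \<le> \<lceil>s / \<epsilon>\<rceil> - 1"
      by linarith
    \<comment> \<open>Since \<open>nat\<close> truncates at 0, the measure drops strictly only if
      the old ceiling is positive.\<close>
    moreover have "0 < \<lceil>s / \<epsilon>\<rceil>"
      using \<open>0 < s\<close> \<epsilon> by simp
    ultimately show ?case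
      by simp
  qed
qed

lemma continuous_on_proj_residual:
  fixes f :: "'a::euclidean_space \<Rightarrow> real"
  assumes "convex S" "closed S" "S \<noteq> {}" "continuous_on T (grad f)"
  shows "continuous_on T (proj_residual f S \<eta>)"
proof -
  have "continuous_on T (\<lambda>x. closest_point S (x - \<eta> *\<^sub>R grad f x))"
    by (rule continuous_on_compose2[OF continuous_on_closest_point[of S UNIV]])
      (use assms in \<open>auto intro!: continuous_intros\<close>)
  then show ?thesis
    unfolding proj_residual_def by (intro continuous_intros)
qed

text \<open>With \<open>p\<close> as its own projected gradient step, the obtuse angle property of
  the projection reads \<open>- \<eta> * (grad f p \<bullet> (y - p)) \<le> 0\<close>.\<close>

lemma stationary_point_if_proj_residual_zero:
  fixes f :: "'a::euclidean_space \<Rightarrow> real"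
  assumes "convex S" "closed S" "p \<in> S" "\<eta> > 0" "proj_residual f S \<eta> p = 0"
  shows "stationary_point f S p"
  unfolding stationary_point_def
proof (intro conjI ballI)
  fix y assume "y \<in> S"
  have "closest_point S (p - \<eta> *\<^sub>R grad f p) = p"
    using assms by (simp add: proj_residual_def)
  with closest_point_dot[OF \<open>convex S\<close> \<open>closed S\<close> \<open>y \<in> S\<close>, of "p - \<eta> *\<^sub>R grad f p"]
  show "0 \<le> grad f p \<bullet> (y - p)"
    using \<open>\<eta> > 0\<close> by (simp add: zero_le_mult_iff)
qed fact

text \<open>A decreasing sequence bounded below converges, so its successive differences vanish in
  the limit and squeeze \<open>e\<close> to 0.\<close>

lemma LIMSEQ_zero_if_decrease:
  fixes F e :: "nat \<Rightarrow> real"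
  assumes "\<And>k. F (Suc k) \<le> F k - e k" "\<And>k. 0 \<le> e k" "\<And>k. B \<le> F k"
  shows "e \<longlonglongrightarrow> 0"
proof -
  have "decseq F"
    using assms(1,2) by (intro decseq_SucI) (smt (verit))
  then obtain l where l: "F \<longlonglongrightarrow> l"
    using decseq_convergent[of F B] assms(3) by blast
  then have "(\<lambda>k. F k - F (Suc k)) \<longlonglongrightarrow> l - l"
    by (intro tendsto_diff LIMSEQ_Suc)
  then have lim: "(\<lambda>k. F k - F (Suc k)) \<longlonglongrightarrow> 0"
    by simp
  show ?thesis
  proof (rule tendsto_sandwich[OF _ _ tendsto_const lim])
    show "\<forall>\<^sub>F k in sequentially. e k \<le> F k - F (Suc k)"
      using assms(1) by (intro always_eventually allI) (smt (verit))
  qed (use assms(2) in auto)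
qed

text \<open>The bound \<open>\<alpha>0\<close> depends on neither the iterate nor the direction, so
  the third clause of \<open>admissible_direction\<close> converts the Armijo decrease into a
  multiple of the squared residual that is uniform in \<open>k\<close>.\<close>

lemma armijo_run_decrease:
  fixes f :: "'a::euclidean_space \<Rightarrow> real"
  assumes run: "armijo_run f S \<eta> a c1 c2 \<gamma> \<delta> x d"
    and diff: "\<And>z. f differentiable (at z)"
    and lip: "L-lipschitz_on S (grad f)" and L: "L > 0"
    and pos: "a > 0" "c1 > 0" "c2 > 0"
    and \<gamma>: "0 < \<gamma>" "\<gamma> < 1" and \<delta>: "0 < \<delta>" "\<delta> < 1"
  defines "\<alpha>0 \<equiv> min a (\<delta> * ((1 - \<gamma>) * c1 / L))"
  shows "x k \<in> S"
    and "f (x (Suc k)) \<le> f (x k) - \<gamma> * \<alpha>0 * c2 * (proj_residual f S \<eta> (x k))\<^sup>2"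
proof -
  define \<alpha> where "\<alpha> k = armijo_step f a \<gamma> \<delta> (x k) (d k)" for k
  have adm: "admissible_direction f S \<eta> a c1 c2 (x k) (d k)"
    and x_Suc: "x (Suc k) = x k + \<alpha> k *\<^sub>R d k" for k
    using run by (auto simp: armijo_run_def \<alpha>_def)
  have \<tau>: "(1 - \<gamma>) * c1 / L > 0"
    using L pos \<gamma> by simp
  then have \<alpha>0: "\<alpha>0 > 0"
    using pos \<delta> by (simp only: \<alpha>0_def min_less_iff_conj mult_pos_pos)
  have \<alpha>: "\<alpha>0 \<le> \<alpha> k \<and> \<alpha> k \<le> a \<and> f (x (Suc k)) \<le> f (x k) + \<gamma> * \<alpha> k * (grad f (x k) \<bullet> d k)" for k
    unfolding x_Suc \<alpha>_def \<alpha>0_def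
    by (rule armijo_step_bounds[OF pos(1) \<delta> \<tau>])
      (rule armijo_condition_small_step[OF diff lip L adm \<gamma>(2)])
  show "x k \<in> S"
  proof (cases k)
    case 0
    then show ?thesis using run by (simp add: armijo_run_def)
  next
    case (Suc j)
    then show ?thesis
      using adm[of j] \<alpha>[of j] \<alpha>0 by (auto simp: x_Suc admissible_direction_def)
  qed
  let ?r = "(proj_residual f S \<eta> (x k))\<^sup>2"
  have "\<gamma> * \<alpha> k * (grad f (x k) \<bullet> d k) \<le> \<gamma> * \<alpha> k * (- c2 * ?r)"
    using adm[of k] \<alpha>[of k] \<alpha>0 \<gamma> by (intro mult_left_mono) (auto simp: admissible_direction_def)
  \<comment> \<open>The factor \<open>- c2 * ?r\<close> is nonpositive, so replacing
    \<open>\<alpha> k\<close> by the smaller \<open>\<alpha>0\<close> increases the product.\<close>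
  also have "\<dots> \<le> \<gamma> * \<alpha>0 * (- c2 * ?r)"
    using \<alpha>[of k] \<gamma> pos by (intro mult_right_mono_neg mult_left_mono) auto
  finally show "f (x (Suc k)) \<le> f (x k) - \<gamma> * \<alpha>0 * c2 * ?r"
    using \<alpha>[of k] by (simp add: mult.assoc)
qed

theorem corollary3p1:
  fixes f :: "real ^ 'n \<Rightarrow> real"
    and S D :: "(real ^ 'n) set"
    and x d :: "nat \<Rightarrow> real ^ 'n"
    and fstar L \<eta> a c1 c2 \<gamma> \<delta> :: real
  assumes "S \<noteq> {}" and "closed S" and "convex S"
    and "smooth_fun f"
    and "\<forall>y\<in>S. f y \<ge> fstar"
    and "open D" and "convex D" and "S \<subseteq> D"
    and "L > 0" and "L-lipschitz_on D (grad f)"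
    and "a > 0" and "c1 > 0" and "c2 > 0" and "\<eta> > 0"
    and "\<gamma> \<in> {0<..<1}" and "\<delta> \<in> {0<..<1}"
    and "armijo_run f S \<eta> a c1 c2 \<gamma> \<delta> x d"
    and "compact S"
  shows "(\<exists>p. accumulation_point x p) \<and>
         (\<forall>p. accumulation_point x p \<longrightarrow> stationary_point f S p)"
proof -
  have diff: "\<And>z. f differentiable (at z)" and cont: "continuous_on UNIV (grad f)"
    using \<open>smooth_fun f\<close> by (auto simp: smooth_fun_def)
  have lip: "L-lipschitz_on S (grad f)"
    using \<open>L-lipschitz_on D (grad f)\<close> \<open>S \<subseteq> D\<close> by (rule lipschitz_on_subset)
  define K where "K = \<gamma> * min a (\<delta> * ((1 - \<gamma>) * c1 / L)) * c2"
  have K: "K > 0"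
    using assms by (auto simp: K_def intro!: mult_pos_pos divide_pos_pos)
  have xS: "x k \<in> S"
    and decrease: "f (x (Suc k)) \<le> f (x k) - K * (proj_residual f S \<eta> (x k))\<^sup>2" for k
    using armijo_run_decrease[of f S \<eta> a c1 c2 \<gamma> \<delta> x d L k] assms diff lip
    by (auto simp: K_def)
  have "(\<lambda>k. K * (proj_residual f S \<eta> (x k))\<^sup>2) \<longlonglongrightarrow> 0"
    \<comment> \<open>The lower bound for the values of \<open>f\<close> along the run is
      \<open>fstar\<close>, available because all iterates stay in \<open>S\<close>.\<close>
    using decrease by (rule LIMSEQ_zero_if_decrease) (use K assms xS in auto)
  then have "(\<lambda>k. (proj_residual f S \<eta> (x k))\<^sup>2) \<longlonglongrightarrow> 0"
    using K by (simp add: tendsto_mult_left_iff[of K _ 0, simplified])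
  then have residual: "(\<lambda>k. proj_residual f S \<eta> (x k)) \<longlonglongrightarrow> 0"
    by simp
  have "\<exists>p. accumulation_point x p"
    using \<open>compact S\<close> xS unfolding compact_def accumulation_point_def by metis
  moreover have "stationary_point f S p" if "accumulation_point x p" for p
  proof -
    obtain r where r: "strict_mono r" and lim: "(x \<circ> r) \<longlonglongrightarrow> p"
      using \<open>accumulation_point x p\<close> by (auto simp: accumulation_point_def)
    have "p \<in> S"
      using closed_sequentially[OF \<open>closed S\<close> _ lim] xS by simp
    have "isCont (proj_residual f S \<eta>) p"
      using continuous_on_proj_residual[OF \<open>convex S\<close> \<open>closed S\<close> \<open>S \<noteq> {}\<close> cont, of \<eta>]
      by (simp add: continuous_on_eq_continuous_at)
    then have "(\<lambda>k. proj_residual f S \<eta> ((x \<circ> r) k)) \<longlonglongrightarrow> proj_residual f S \<eta> p"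
      using lim by (rule isCont_tendsto_compose)
    \<comment> \<open>The residuals vanish along the full sequence, hence along every subsequence;
      this identifies the limit given by continuity.\<close>
    moreover have "(\<lambda>k. proj_residual f S \<eta> ((x \<circ> r) k)) \<longlonglongrightarrow> 0"
      using LIMSEQ_subseq_LIMSEQ[OF residual r] by (simp add: o_def)
    ultimately have "proj_residual f S \<eta> p = 0"
      by (rule LIMSEQ_unique)
    with \<open>convex S\<close> \<open>closed S\<close> \<open>p \<in> S\<close> \<open>\<eta> > 0\<close> show ?thesis
      by (rule stationary_point_if_proj_residual_zero)
  qed
  ultimately show ?thesis
    by blast
qed

end
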